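(* Let $\mathcal{H}$ be a complex Hilbert space, let $A\in\mathcal{B}(\mathcal{H})$ be a positive operator, and let $T\in\mathcal{B}_A(\mathcal{H})$. Then the following hold. (i) $w_A(T)=\frac{1}{2}\|T\|_A$ if and only if $W_A(T)$ is a circular disk with center at the origin and radius $\frac{1}{2}\|T\|_A$. (ii) $w_A(T)=\sqrt{\frac{1}{4}\|T^{\sharp_A}T+TT^{\sharp_A}\|_A}$ if and only if $W_A(T)$ is a circular disk with center at the origin and radius $\sqrt{\frac{1}{4}\|T^{\sharp_A}T+TT^{\sharp_A}\|_A}$.
   Context: $\mathcal{B}(\mathcal{H})$ is the algebra of bounded linear operators on the complex Hilbert space $\mathcal{H}$ with inner product $\langle\cdot,\cdot\rangle$; $A\in\mathcal{B}(\mathcal{H})$ is positive (i.e. $\langle Ax,x\rangle\ge 0$ for all $x$), not necessarily injective. Put $\langle x,y\rangle_A=\langle Ax,y\rangle$ and $\|x\|_A=\sqrt{\langle x,x\rangle_A}$ (a seminorm on $\mathcal{H}$). $R(S)$ denotes the range of $S$ and $\overline{R(S)}$ its norm closure. $\mathcal{B}_A(\mathcal{H})=\{T\in\mathcal{B}(\mathcal{H}): R(T^*A)\subseteq R(A)\}$, equivalently the set of $T\in\mathcal{B}(\mathcal{H})$ for which there is $S\in\mathcal{B}(\mathcal{H})$ with $AS=T^*A$. For $T\in\mathcal{B}_A(\mathcal{H})$, $T^{\sharp_A}$ denotes the unique $X\in\mathcal{B}(\mathcal{H})$ with $AX=T^*A$ and $R(X)\subseteq\overline{R(A)}$. For $T\in\mathcal{B}_A(\mathcal{H})$: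 $\|T\|_A=\sup\{\|Tx\|_A: x\in\overline{R(A)},\ \|x\|_A=1\}=\sup\{\|Tx\|_A: x\in\mathcal{H},\ \|x\|_A=1\}$ (finite); the $A$-numerical range is $W_A(T)=\{\langle Tx,x\rangle_A: x\in\mathcal{H},\ \|x\|_A=1\}\subseteq\mathbb{C}$, and the $A$-numerical radius is $w_A(T)=\sup\{|\langle Tx,x\rangle_A|: x\in\mathcal{H},\ \|x\|_A=1\}$. A "circular disk with center at the origin and radius $r\ge 0$" is understood up to boundary points: a set $D\subseteq\mathbb{C}$ with $\{z:|z|<r\}\subseteq D\subseteq\{z:|z|\le r\}$ (the $A$-numerical range need not be closed or open). *)

theory Defs
  imports "HOL-Analysis.Analysis"
begin

class complex_vector = real_vector +
  fixes scaleC :: "complex \<Rightarrow> 'a \<Rightarrow> 'a" (infixr \<open>*\<^sub>C\<close> 75)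
  assumes scaleC_add_right: "a *\<^sub>C (x + y) = a *\<^sub>C x + a *\<^sub>C y"
    and scaleC_add_left: "(a + b) *\<^sub>C x = a *\<^sub>C x + b *\<^sub>C x"
    and scaleC_scaleC: "a *\<^sub>C (b *\<^sub>C x) = (a * b) *\<^sub>C x"
    and scaleC_of_real: "complex_of_real r *\<^sub>C x = r *\<^sub>R x"

text \<open>The inner product is linear in its first argument and conjugate-linear in its second.\<close>

class complex_inner = complex_vector + real_normed_vector +
  fixes cinner :: "'a \<Rightarrow> 'a \<Rightarrow> complex"
  assumes cinner_commute: "cinner x y = cnj (cinner y x)"
    and cinner_add_left: "cinner (x + y) z = cinner x z + cinner y z"
    and cinner_scaleC_left: "cinner (a *\<^sub>C x) y = a * cinner x y"
    and cinner_ge_zero: "0 \<le> Re (cinner x x)"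
    and cinner_eq_zero_iff: "cinner x x = 0 \<longleftrightarrow> x = 0"
    and norm_eq_sqrt_cinner: "norm x = sqrt (Re (cinner x x))"

class chilbert_space = complex_inner + banach

definition bounded_clinear :: "('a::complex_inner \<Rightarrow> 'a) \<Rightarrow> bool" where
  "bounded_clinear T \<longleftrightarrow> bounded_linear T \<and> (\<forall>c x. T (c *\<^sub>C x) = c *\<^sub>C T x)"

definition positive_op :: "('a::complex_inner \<Rightarrow> 'a) \<Rightarrow> bool" where
  "positive_op A \<longleftrightarrow> (\<forall>x. cinner (A x) x \<in> \<real> \<and> 0 \<le> Re (cinner (A x) x))"

text \<open>For a bounded operator on a Hilbert space the adjoint exists (Riesz) and is unique, so
  the definite description is meaningful.\<close>

definition cadjoint :: "('a::complex_inner \<Rightarrow> 'a) \<Rightarrow> 'a \<Rightarrow> 'a" where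
  "cadjoint T = (THE S. \<forall>x y. cinner (T x) y = cinner x (S y))"

definition A_inner :: "('a::complex_inner \<Rightarrow> 'a) \<Rightarrow> 'a \<Rightarrow> 'a \<Rightarrow> complex" where
  "A_inner A x y = cinner (A x) y"

definition A_norm :: "('a::complex_inner \<Rightarrow> 'a) \<Rightarrow> 'a \<Rightarrow> real" where
  "A_norm A x = sqrt (Re (A_inner A x x))"

definition B_A :: "('a::complex_inner \<Rightarrow> 'a) \<Rightarrow> ('a \<Rightarrow> 'a) set" where
  "B_A A = {T. bounded_clinear T \<and> range (cadjoint T \<circ> A) \<subseteq> range A}"

text \<open>For positive \<open>A\<close> and \<open>T \<in> B_A A\<close> there is exactly one such \<open>X\<close> (Douglas).\<close>

definition A_sharp :: "('a::complex_inner \<Rightarrow> 'a) \<Rightarrow> ('a \<Rightarrow> 'a) \<Rightarrow> 'a \<Rightarrow> 'a" where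
  "A_sharp A T =
    (THE X. bounded_clinear X \<and> A \<circ> X = cadjoint T \<circ> A \<and> range X \<subseteq> closure (range A))"

text \<open>The two suprema below are suprema of sets of nonnegative reals. Inserting \<open>0\<close> does not
  change them unless the set is empty, which happens exactly when \<open>A = 0\<close>; it fixes the
  convention that the supremum is then \<open>0\<close> (in HOL, \<open>Sup {}\<close> is unspecified on the reals).\<close>

definition A_opnorm :: "('a::complex_inner \<Rightarrow> 'a) \<Rightarrow> ('a \<Rightarrow> 'a) \<Rightarrow> real" where
  "A_opnorm A T = Sup (insert 0 {A_norm A (T x) | x. A_norm A x = 1})"

definition A_numrange :: "('a::complex_inner \<Rightarrow> 'a) \<Rightarrow> ('a \<Rightarrow> 'a) \<Rightarrow> complex set" where
  "A_numrange A T = {A_inner A (T x) x | x. A_norm A x = 1}"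

definition A_numradius :: "('a::complex_inner \<Rightarrow> 'a) \<Rightarrow> ('a \<Rightarrow> 'a) \<Rightarrow> real" where
  "A_numradius A T = Sup (insert 0 {cmod (A_inner A (T x) x) | x. A_norm A x = 1})"

text \<open>A circular disk about the origin, with no condition on which boundary points it contains.
  For \<open>r = 0\<close> both \<open>{0}\<close> and \<open>{}\<close> qualify; the numerical range is empty exactly when \<open>A = 0\<close>.\<close>

definition circular_disk_at_0 :: "complex set \<Rightarrow> real \<Rightarrow> bool" where
  "circular_disk_at_0 D r \<longleftrightarrow> 0 \<le> r \<and> ball 0 r \<subseteq> D \<and> D \<subseteq> cball 0 r"

end

theory Submission imports Defs begin

text \<open>
  The argument uses only that \<open>T\<close> and \<open>X = T\<^sup>\<sharp>\<close> are mutually adjoint and bounded for the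
  positive semidefinite form \<open>\<langle>x, y\<rangle>\<^sub>A\<close>. Put \<open>B = X T + T X\<close> and \<open>G c = c T + cnj c X\<close> for
  \<open>|c| = 1\<close>; then \<open>\<parallel>G c\<parallel> \<le> 2 w\<close> and \<open>(G c)\<^sup>2 + (G (\<i> c))\<^sup>2 = 2 B\<close>, so
  \<open>\<parallel>T\<parallel>\<^sup>2 \<le> \<parallel>B\<parallel> \<le> 4 w\<^sup>2\<close> and the first equivalence reduces to the second. If \<open>\<parallel>B\<parallel> = 4 w\<^sup>2\<close>, vectors
  almost maximising \<open>\<langle>B x, x\<rangle>\<close> are almost eigenvectors of every \<open>(G c)\<^sup>2\<close>, and from them one
  gets that the largest value of \<open>Re (c z)\<close> over the numerical range is \<open>w\<close> for every \<open>c\<close>, not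
  merely that of \<open>|Re (c z)|\<close>. By convexity the numerical range contains the open disk.
\<close>

section \<open>Scalars and real quadratics\<close>

lemma scaleC_minus_one: "(- 1) *\<^sub>C x = - (x :: 'a::complex_vector)"
  using scaleC_of_real[of "- 1" x] by simp

lemma scaleC_one: "1 *\<^sub>C x = (x :: 'a::complex_vector)"
  using scaleC_of_real[of 1 x] by simp

text \<open>At its vertex \<open>- b / c\<close> the quadratic equals \<open>a - b^2 / c\<close>;
  for \<open>c = 0\<close> a nonconstant affine function would become negative.\<close>

lemma quadratic_nonneg_imp_discriminant:
  fixes a b c :: real
  assumes "\<And>t. 0 \<le> a + 2 * t * b + t\<^sup>2 * c" and c: "0 \<le> c"
  shows "b\<^sup>2 \<le> a * c"
proof (cases "c = 0")
  case True
  have "b = 0"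
  proof (rule ccontr)
    assume "b \<noteq> 0"
    \<comment> \<open>At this \<open>t\<close> the affine function takes the value -1.\<close>
    then show False
      using assms(1)[of "- (a + 1) / (2 * b)"] True by (simp add: field_simps)
  qed
  then show ?thesis using True by simp
next
  case False
  with c have "c > 0" by simp
  have "0 \<le> a - b\<^sup>2 / c"
    using assms(1)[of "- b / c"] \<open>c > 0\<close> by (simp add: power2_eq_square field_simps)
  then show ?thesis using \<open>c > 0\<close> by (simp add: field_simps)
qed

lemma exists_unimodular_rotation: "\<exists>c. cmod c = 1 \<and> c * z = of_real (cmod z)"
proof (cases "z = 0")
  case True
  then show ?thesis by (intro exI[of _ 1]) simp
next
  case False
  have "cnj z * z = of_real (cmod z) * of_real (cmod z)"
    using complex_norm_square[of z] by (simp add: power2_eq_square mult.commute)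
  then show ?thesis using False
    by (intro exI[of _ "cnj z / of_real (cmod z)"]) (simp add: norm_divide)
qed

section \<open>Positive semidefinite sesquilinear forms\<close>

text \<open>\<open>q\<close> may be degenerate, so \<open>sn\<close> is in general only a seminorm.
  The locale serves both the inner product and \<open>A_inner A\<close>.\<close>

locale psd_form =
  fixes q :: "'a::complex_vector \<Rightarrow> 'a \<Rightarrow> complex"
  assumes q_commute: "q x y = cnj (q y x)"
    and q_add_left: "q (x + y) z = q x z + q y z"
    and q_scaleC_left: "q (a *\<^sub>C x) y = a * q x y"
    and q_ge_zero: "0 \<le> Re (q x x)"
begin

lemma q_add_right: "q x (y + z) = q x y + q x z"
  by (subst (1 2 3) q_commute) (simp add: q_add_left)

lemma q_scaleC_right: "q x (a *\<^sub>C y) = cnj a * q x y"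
  by (subst (1 2) q_commute) (simp add: q_scaleC_left)

lemma q_scaleR_left: "q (r *\<^sub>R x) y = of_real r * q x y"
  using q_scaleC_left[of "of_real r" x y] by (simp add: scaleC_of_real)

lemma q_scaleR_right: "q x (r *\<^sub>R y) = of_real r * q x y"
  using q_scaleC_right[of x "of_real r" y] by (simp add: scaleC_of_real)

lemma q_minus_left: "q (- x) y = - q x y"
  using q_scaleC_left[of "- 1" x y] by (simp add: scaleC_minus_one)

lemma q_minus_right: "q x (- y) = - q x y"
  using q_scaleC_right[of x "- 1" y] by (simp add: scaleC_minus_one)

lemma q_diff_left: "q (x - y) z = q x z - q y z"
  using q_add_left[of x "- y" z] by (simp add: q_minus_left)

lemma q_diff_right: "q x (y - z) = q x y - q x z"
  using q_add_right[of x y "- z"] by (simp add: q_minus_right)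

lemma q_zero: "q x 0 = 0"
  using q_diff_right[of x 0 0] by simp

lemmas q_simps = q_add_left q_add_right q_scaleC_left q_scaleC_right q_scaleR_left q_scaleR_right q_minus_left q_minus_right
  q_diff_left q_diff_right

lemma q_self: "q x x = of_real (Re (q x x))"
  using q_commute[of x x] by (simp add: complex_eq_iff)

definition sn :: "'a \<Rightarrow> real" where
  "sn x = sqrt (Re (q x x))"

lemma sn_ge_zero [simp]: "0 \<le> sn x"
  by (simp add: sn_def q_ge_zero)

lemma sn_power2: "(sn x)\<^sup>2 = Re (q x x)"
  by (simp add: sn_def q_ge_zero)

lemma q_self_sn: "q x x = of_real ((sn x)\<^sup>2)"
  unfolding sn_power2 by (rule q_self)

lemma Re_q_commute: "Re (q x y) = Re (q y x)"
  by (subst q_commute) simp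

lemma sn_add_power2: "(sn (x + y))\<^sup>2 = (sn x)\<^sup>2 + 2 * Re (q x y) + (sn y)\<^sup>2"
  unfolding sn_power2 by (simp add: q_simps Re_q_commute[of y x])

lemma sn_diff_power2: "(sn (x - y))\<^sup>2 = (sn x)\<^sup>2 - 2 * Re (q x y) + (sn y)\<^sup>2"
  unfolding sn_power2 by (simp add: q_simps Re_q_commute[of y x])

lemma sn_parallelogram: "(sn (x + y))\<^sup>2 + (sn (x - y))\<^sup>2 = 2 * (sn x)\<^sup>2 + 2 * (sn y)\<^sup>2"
  by (simp add: sn_add_power2 sn_diff_power2)

lemma sn_scaleC: "sn (a *\<^sub>C x) = cmod a * sn x"
proof -
  have "complex_of_real ((sn (a *\<^sub>C x))\<^sup>2) = of_real ((cmod a)\<^sup>2) * q x x"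
    unfolding q_self_sn[symmetric] complex_norm_square by (simp only: q_simps mult_ac)
  then have "complex_of_real ((sn (a *\<^sub>C x))\<^sup>2) = of_real ((cmod a * sn x)\<^sup>2)"
    unfolding q_self_sn by (simp add: power_mult_distrib)
  then have "(sn (a *\<^sub>C x))\<^sup>2 = (cmod a * sn x)\<^sup>2"
    by (simp only: of_real_eq_iff)
  then show ?thesis
    by (rule power2_eq_imp_eq) simp_all
qed

lemma sn_scaleR: "sn (r *\<^sub>R x) = \<bar>r\<bar> * sn x"
  using sn_scaleC[of "of_real r" x] by (simp add: scaleC_of_real)

lemma sn_minus [simp]: "sn (- x) = sn x"
  using sn_scaleR[of "- 1" x] by simp

text \<open>A unimodular factor on \<open>x\<close> replaces \<open>q x y\<close> by its modulus;
  the squared seminorm of \<open>c x + t y\<close> is then a nonnegative quadratic in the real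
  \<open>t\<close>.\<close>

lemma Cauchy_Schwarz: "cmod (q x y) \<le> sn x * sn y"
proof -
  obtain c where c: "cmod c = 1" "c * q x y = of_real (cmod (q x y))"
    using exists_unimodular_rotation by blast
  have "0 \<le> (sn x)\<^sup>2 + 2 * t * cmod (q x y) + t\<^sup>2 * (sn y)\<^sup>2" for t
  proof -
    have "0 \<le> (sn (c *\<^sub>C x + complex_of_real t *\<^sub>C y))\<^sup>2" by simp
    also have "\<dots> = (sn x)\<^sup>2 + 2 * t * cmod (q x y) + t\<^sup>2 * (sn y)\<^sup>2"
      unfolding sn_add_power2 sn_scaleC by (simp add: q_simps c power_mult_distrib)
    finally show ?thesis .
  qed
  from quadratic_nonneg_imp_discriminant[OF this]
  have "(cmod (q x y))\<^sup>2 \<le> (sn x * sn y)\<^sup>2" by (simp add: power_mult_distrib)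
  then show ?thesis by (rule power2_le_imp_le) simp
qed

lemma Re_Cauchy_Schwarz: "Re (q x y) \<le> sn x * sn y"
  using Cauchy_Schwarz[of x y] complex_Re_le_cmod[of "q x y"] by linarith

lemma sn_triangle: "sn (x + y) \<le> sn x + sn y"
proof (rule power2_le_imp_le)
  show "(sn (x + y))\<^sup>2 \<le> (sn x + sn y)\<^sup>2"
    using Re_Cauchy_Schwarz[of x y] by (simp add: sn_add_power2 power2_sum)
qed simp

lemma sn_triangle_diff: "sn (x - y) \<le> sn x + sn y"
  using sn_triangle[of x "- y"] by simp

text \<open>Polarising the quadratic form of \<open>H\<close> and using the parallelogram law bounds
  \<open>Re (q (H u) v)\<close> by squared seminorms. Testing this with \<open>u = x\<close> and all
  real multiples \<open>v\<close> of \<open>H x\<close> gives a quadratic whose discriminant is the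
  estimate.\<close>

lemma symmetric_bound:
  assumes add: "\<And>x y. H (x + y) = H x + H y" and scale: "\<And>c x. H (c *\<^sub>C x) = c *\<^sub>C H x"
    and sym: "\<And>x y. q (H x) y = q x (H y)"
    and bound: "\<And>x. \<bar>Re (q (H x) x)\<bar> \<le> K * (sn x)\<^sup>2" and K: "0 \<le> K"
  shows "sn (H x) \<le> K * sn x"
proof -
  have HR: "H (r *\<^sub>R v) = r *\<^sub>R H v" for r v
    using scale[of "of_real r" v] by (simp add: scaleC_of_real)
  have diff: "H (u - v) = H u - H v" for u v using add[of u "- v"] HR[of "- 1" v] by simp
  have *: "2 * Re (q (H u) v) \<le> K * ((sn u)\<^sup>2 + (sn v)\<^sup>2)" for u v
  proof -
    have "4 * Re (q (H u) v) = Re (q (H (u + v)) (u + v)) - Re (q (H (u - v)) (u - v))"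
      unfolding diff add by (simp add: q_simps sym[of v u] Re_q_commute[of v "H u"])
    also have "\<dots> \<le> K * (sn (u + v))\<^sup>2 + K * (sn (u - v))\<^sup>2"
      using bound[of "u + v"] bound[of "u - v"] by linarith
    also have "\<dots> = K * (2 * (sn u)\<^sup>2 + 2 * (sn v)\<^sup>2)"
      unfolding sn_parallelogram[symmetric] by (rule distrib_left[symmetric])
    finally show ?thesis by (simp add: algebra_simps)
  qed
  have "0 \<le> K * (sn x)\<^sup>2 + 2 * t * (- (sn (H x))\<^sup>2) + t\<^sup>2 * (K * (sn (H x))\<^sup>2)" for t
  proof -
    have "Re (q (H x) (t *\<^sub>R H x)) = t * (sn (H x))\<^sup>2"
      by (simp add: q_scaleR_right sn_power2)
    moreover have "(sn (t *\<^sub>R H x))\<^sup>2 = t\<^sup>2 * (sn (H x))\<^sup>2"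
      by (simp add: sn_scaleR power_mult_distrib)
    ultimately show ?thesis
      using *[of x "t *\<^sub>R H x"] by (simp only:) (simp add: algebra_simps)
  qed
  from quadratic_nonneg_imp_discriminant[OF this] K
  have "((sn (H x))\<^sup>2)\<^sup>2 \<le> K * (sn x)\<^sup>2 * (K * (sn (H x))\<^sup>2)"
    by simp
  then have "(sn (H x))\<^sup>2 * (sn (H x))\<^sup>2 \<le> (K * sn x)\<^sup>2 * (sn (H x))\<^sup>2"
    by (simp only: power2_eq_square mult_ac)
  then have "sn (H x) = 0 \<or> (sn (H x))\<^sup>2 \<le> (K * sn x)\<^sup>2"
    unfolding mult_le_cancel_right by auto
  moreover have "0 \<le> K * sn x" using K by simp
  ultimately show ?thesis
    using power2_le_imp_le by metis
qed

section \<open>Suprema over vectors of seminorm 1\<close>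

text \<open>The inserted 0 follows the convention of \<open>A_opnorm\<close> and
  \<open>A_numradius\<close>, which thereby become instances; it decides the value when no vector
  has seminorm 1.\<close>

definition unit_sup :: "('a \<Rightarrow> real) \<Rightarrow> real" where
  "unit_sup f = Sup (insert 0 {f x | x. sn x = 1})"

lemma unit_sup_least:
  assumes "\<And>x. sn x = 1 \<Longrightarrow> f x \<le> L" and "0 \<le> L"
  shows "unit_sup f \<le> L"
  unfolding unit_sup_def using assms by (intro cSup_least) auto

lemma unit_sup_upper:
  assumes "\<And>x. sn x = 1 \<Longrightarrow> f x \<le> K" and "sn x = 1"
  shows "f x \<le> unit_sup f"
  unfolding unit_sup_def
  \<comment> \<open>The bound \<open>max 0 K\<close> also dominates the inserted 0 when
    \<open>K\<close> is negative.\<close>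
  using assms by (intro cSup_upper bdd_aboveI[of _ "max 0 K"]) (auto simp: le_max_iff_disj)

lemma unit_sup_ge_zero:
  assumes "\<And>x. sn x = 1 \<Longrightarrow> f x \<le> K"
  shows "0 \<le> unit_sup f"
  unfolding unit_sup_def
  using assms by (intro cSup_upper bdd_aboveI[of _ "max 0 K"]) (auto simp: le_max_iff_disj)

end

section \<open>Adjoint pairs of operators and their numerical range\<close>

text \<open>\<open>T_bounded\<close> is boundedness in the seminorm: \<open>T\<close> then preserves
  null vectors, and the numerical range is bounded.\<close>

locale adjoint_pair = psd_form +
  fixes T T' :: "'a \<Rightarrow> 'a" and C :: real
  assumes T_add: "T (x + y) = T x + T y" and T_scaleC: "T (c *\<^sub>C x) = c *\<^sub>C T x"
    and T'_add: "T' (x + y) = T' x + T' y" and T'_scaleC: "T' (c *\<^sub>C x) = c *\<^sub>C T' x"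
    and T_adjoint: "q (T x) y = q x (T' y)"
    and T_bounded: "sn (T x) \<le> C * sn x"
begin

lemma T'_adjoint: "q (T' x) y = q x (T y)"
  by (subst (1 2) q_commute) (simp add: T_adjoint)

definition numrange :: "complex set" where
  "numrange = {q (T x) x | x. sn x = 1}"

lemma q_T_null:
  assumes "sn v = 0"
  shows "q (T v) y = 0" "q (T y) v = 0" "q v y = 0" "q y v = 0"
proof -
  have "sn (T v) = 0" using T_bounded[of v] assms sn_ge_zero[of "T v"] by simp
  with assms show "q (T v) y = 0" "q (T y) v = 0" "q v y = 0" "q y v = 0"
    using Cauchy_Schwarz[of "T v" y] Cauchy_Schwarz[of "T y" v]
      Cauchy_Schwarz[of v y] Cauchy_Schwarz[of y v] by auto
qed

lemma numrangeI:
  assumes "sn v \<noteq> 0" "q (T v) v = z * of_real ((sn v)\<^sup>2)"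
  shows "z \<in> numrange"
proof -
  let ?u = "complex_of_real (1 / sn v) *\<^sub>C v"
  have "sn ?u = 1" using assms(1) by (simp add: sn_scaleC norm_divide)
  moreover have "q (T ?u) ?u = z"
    using assms by (simp add: T_scaleC q_simps power2_eq_square)
  ultimately show ?thesis unfolding numrange_def by (intro CollectI exI[of _ ?u]) simp
qed

text \<open>The Toeplitz--Hausdorff theorem. The form \<open>s\<close> is the affine normalisation of \<open>q (T u) v\<close>
  with \<open>s x x = 0\<close> and \<open>s y y = 1\<close>; rotating \<open>x\<close> makes it real on the segment from \<open>x\<close> to \<open>y\<close>.\<close>

lemma convex_numrange: "convex numrange"
proof (rule convexI)
  fix z1 z2 :: complex and a b :: real
  assume z: "z1 \<in> numrange" "z2 \<in> numrange" and ab: "0 \<le> a" "0 \<le> b" "a + b = 1"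
  show "a *\<^sub>R z1 + b *\<^sub>R z2 \<in> numrange"
  proof (cases "z1 = z2")
    case True
    then show ?thesis using z ab by (simp only: scaleR_add_left[symmetric] scaleR_one)
  next
    case False
    obtain x0 y where x0: "sn x0 = 1" "q (T x0) x0 = z1" and y: "sn y = 1" "q (T y) y = z2"
      using z by (auto simp: numrange_def)
    define s where "s u v = (q (T u) v - z1 * q u v) / (z2 - z1)" for u v
    have s_add: "s (u + v) w = s u w + s v w" "s u (v + w) = s u v + s u w" for u v w
      by (simp_all add: s_def T_add q_simps algebra_simps add_divide_distrib diff_divide_distrib)
    have s_scale: "s (c *\<^sub>C u) v = c * s u v" "s u (c *\<^sub>C v) = cnj c * s u v" for c u v
      by (simp_all add: s_def T_scaleC q_simps algebra_simps diff_divide_distrib)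
    have qs: "q (T v) v = z1 * of_real ((sn v)\<^sup>2) + (z2 - z1) * s v v" for v
      using False by (simp add: s_def q_self_sn)
    have s_null: "s v w = 0" "s w v = 0" if "sn v = 0" for v w
      using q_T_null[OF that] by (simp_all add: s_def)
    obtain c where c: "cmod c = 1" "c * (s x0 y - cnj (s y x0)) = of_real (cmod (s x0 y - cnj (s y x0)))"
      using exists_unimodular_rotation by blast
    define x where "x = c *\<^sub>C x0"
    have snx: "sn x = 1" by (simp add: x_def sn_scaleC c x0)
    have sx: "s x x = 0" by (simp add: x_def s_scale) (simp add: s_def x0 q_self_sn)
    have sy: "s y y = 1" using False by (simp add: s_def y q_self_sn)
    \<comment> \<open>Conjugating \<open>cnj c * s y x0\<close> flips the sign of its imaginary
      part, which explains the difference in the choice of \<open>c\<close>.\<close>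
    have "Im (s x y + s y x) = Im (c * (s x0 y - cnj (s y x0)))"
      by (simp add: x_def s_scale algebra_simps)
    then have im: "Im (s x y + s y x) = 0" by (simp add: c)
    define R where "R = Re (s x y + s y x)"
    have R: "s x y + s y x = of_real R" using im by (simp add: R_def complex_eq_iff)
    define v where "v t = complex_of_real (1 - t) *\<^sub>C x + complex_of_real t *\<^sub>C y" for t
    define \<phi> where "\<phi> t = (1 - t) * t * R + t\<^sup>2" for t :: real
    have sv: "s (v t) (v t) = of_real (\<phi> t)" for t
    proof -
      have "s (v t) (v t) = of_real ((1 - t) * t) * (s x y + s y x) + of_real (t\<^sup>2)"
        by (simp add: v_def s_add s_scale sx sy power2_eq_square algebra_simps)
      then show ?thesis by (simp add: R \<phi>_def)
    qed
    have snv: "(sn (v t))\<^sup>2 = (1 - t)\<^sup>2 + 2 * ((1 - t) * t * Re (q x y)) + t\<^sup>2" for t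
      unfolding v_def scaleC_of_real
      by (simp add: sn_add_power2 sn_scaleR power_mult_distrib snx y q_simps)
    \<comment> \<open>A null \<open>v t\<close> pairs to 0 with \<open>x\<close> and
      \<open>y\<close> under \<open>s\<close>; the two resulting equations force
      \<open>t = 0\<close>, but \<open>v 0 = x\<close> has seminorm 1.\<close>
    have nz: "sn (v t) \<noteq> 0" for t
    proof
      assume n: "sn (v t) = 0"
      have "s (v t) x = 0" "s y (v t) = 0" using s_null[OF n] by auto
      then have "of_real t * s y x = 0" "of_real (1 - t) * s y x + of_real t = 0"
        by (simp_all add: v_def s_add s_scale sx sy)
      then have "t = 0" by auto
      then show False using n snx by (simp add: v_def scaleC_one scaleC_of_real[of 0, simplified])
    qed
    \<comment> \<open>The normalised \<open>v t\<close> attains the value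
      \<open>z1 + f t * (z2 - z1)\<close>, so a \<open>t\<close> with \<open>f t = b\<close> gives
      the desired convex combination.\<close>
    define f where "f t = \<phi> t / (sn (v t))\<^sup>2" for t
    have "continuous_on {0..1} f"
    proof -
      have "(1 - t)\<^sup>2 + 2 * ((1 - t) * t * Re (q x y)) + t\<^sup>2 \<noteq> 0" for t
        using nz[of t] by (simp flip: snv)
      then show ?thesis unfolding f_def \<phi>_def snv by (intro continuous_intros) auto
    qed
    moreover have "f 0 = 0" "f 1 = 1" by (simp_all add: f_def \<phi>_def snv)
    ultimately obtain t where t: "f t = b"
      using IVT'[of f 0 b 1] ab by auto
    have "\<phi> t = b * (sn (v t))\<^sup>2" using t nz[of t] by (simp add: f_def field_simps)
    then have "q (T (v t)) (v t) = (z1 + (z2 - z1) * of_real b) * of_real ((sn (v t))\<^sup>2)"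
      by (simp add: qs sv algebra_simps)
    moreover have "z1 + (z2 - z1) * of_real b = a *\<^sub>R z1 + b *\<^sub>R z2"
    proof -
      have a: "a = 1 - b" using ab by simp
      show ?thesis unfolding a by (simp add: scaleR_conv_of_real algebra_simps)
    qed
    ultimately show ?thesis using numrangeI[OF nz] by metis
  qed
qed

section \<open>Hermitian parts of the rotated operator\<close>

text \<open>For \<open>cmod c = 1\<close> this is twice the real part of \<open>c T\<close> with
  respect to \<open>q\<close>; on unit vectors the supremum of its quadratic form is twice the
  support function of the numerical range in direction \<open>cnj c\<close>.\<close>

definition G :: "complex \<Rightarrow> 'a \<Rightarrow> 'a" where
  "G c x = c *\<^sub>C T x + cnj c *\<^sub>C T' x"

definition B :: "'a \<Rightarrow> 'a" where
  "B x = T' (T x) + T (T' x)"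

lemma G_add: "G c (x + y) = G c x + G c y"
  by (simp add: G_def T_add T'_add scaleC_add_right)

lemma G_scaleC: "G c (a *\<^sub>C x) = a *\<^sub>C G c x"
  by (simp add: G_def T_scaleC T'_scaleC scaleC_add_right scaleC_scaleC mult.commute)

lemma G_scaleR: "G c (r *\<^sub>R x) = r *\<^sub>R G c x"
  using G_scaleC[of c "of_real r" x] by (simp add: scaleC_of_real)

lemma G_symmetric: "q (G c x) y = q x (G c y)"
  by (simp add: G_def q_simps T_adjoint T'_adjoint)

lemma Re_q_G: "Re (q (G c x) x) = 2 * Re (c * q (T x) x)"
proof -
  have "q (T' x) x = cnj (q (T x) x)" unfolding T'_adjoint by (subst q_commute) simp
  then show ?thesis by (simp add: G_def q_simps)
qed

lemma B_add: "B (x + y) = B x + B y"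
  by (simp add: B_def T_add T'_add)

lemma B_scaleC: "B (c *\<^sub>C x) = c *\<^sub>C B x"
  by (simp add: B_def T_scaleC T'_scaleC scaleC_add_right)

lemma B_symmetric: "q (B x) y = q x (B y)"
  by (simp add: B_def q_simps T_adjoint T'_adjoint)

lemma Re_q_B: "Re (q (B x) x) = (sn (T x))\<^sup>2 + (sn (T' x))\<^sup>2"
  by (simp add: B_def q_simps T_adjoint T'_adjoint sn_power2)

text \<open>\<open>G c x\<close> is the sum, and \<open>G (\<i> * c) x\<close> is
  \<open>\<i>\<close> times the difference, of \<open>c T x\<close> and \<open>cnj c T' x\<close>;
  this is their parallelogram law. The right side does not depend on \<open>c\<close>, so one vector
  that is almost extremal for \<open>B\<close> serves all rotations.\<close>

lemma sn_G_power2: "cmod c = 1 \<Longrightarrow> (sn (G c x))\<^sup>2 + (sn (G (\<i> * c) x))\<^sup>2 = 2 * Re (q (B x) x)"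
proof -
  assume c: "cmod c = 1"
  have "G (\<i> * c) x = \<i> *\<^sub>C (c *\<^sub>C T x - cnj c *\<^sub>C T' x)"
    using scaleC_scaleC[of "- 1" "cnj c" "T' x"]
    by (simp add: G_def scaleC_add_right[of \<i> _ "- (cnj c *\<^sub>C T' x)", simplified]
        scaleC_scaleC scaleC_minus_one[symmetric])
  then show ?thesis
    using sn_parallelogram[of "c *\<^sub>C T x" "cnj c *\<^sub>C T' x"] c
    by (simp add: sn_scaleC Re_q_B) (simp add: G_def)
qed

lemma G_add_G: "G c x + G d x = G (c + d) x"
  by (simp add: G_def scaleC_add_left)

text \<open>The factor has to be real because \<open>G\<close> is only real-linear in its
  index.\<close>

lemma G_scale_index: "G (complex_of_real r * c) x = r *\<^sub>R G c x"
  by (simp add: G_def scaleC_of_real[symmetric] scaleC_scaleC scaleC_add_right)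

section \<open>Almost extremal vectors under a numerical radius bound\<close>

context
  fixes w :: real
  assumes w_ge_zero: "0 \<le> w" and radius_bound: "\<And>x. cmod (q (T x) x) \<le> w * (sn x)\<^sup>2"
begin

lemma sn_G_le: "cmod c = 1 \<Longrightarrow> sn (G c x) \<le> 2 * w * sn x"
proof (rule symmetric_bound[where H = "G c"])
  assume c: "cmod c = 1"
  show "\<bar>Re (q (G c x) x)\<bar> \<le> 2 * w * (sn x)\<^sup>2" for x
    using radius_bound[of x] abs_Re_le_cmod[of "c * q (T x) x"] c
    by (simp add: Re_q_G norm_mult)
qed (use w_ge_zero in \<open>simp_all add: G_add G_scaleC G_symmetric\<close>)

lemma sn_G_power2_le: "cmod c = 1 \<Longrightarrow> (sn (G c x))\<^sup>2 \<le> 4 * w\<^sup>2 * (sn x)\<^sup>2"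
  using power_mono[OF sn_G_le, of c x 2] by (simp add: power_mult_distrib)

lemma Re_q_B_le: "Re (q (B x) x) \<le> 4 * w\<^sup>2 * (sn x)\<^sup>2"
  using sn_G_power2[of 1 x] sn_G_power2_le[of 1 x] sn_G_power2_le[of \<i> x] by simp

text \<open>With \<open>m = 2 * w\<close>, the bound on \<open>G (\<i> * c) x\<close> leaves at
  least \<open>m^2 - 2 * \<epsilon>\<close> for the square of \<open>sn (G c x)\<close>. By
  symmetry, \<open>m^2\<close> times this square is the cross term in the expansion of the squared
  seminorm of \<open>m^2 x - G c (G c x)\<close>.\<close>

lemma almost_eigenvector:
  assumes c: "cmod c = 1" and x: "sn x = 1" "4 * w\<^sup>2 - \<epsilon> \<le> Re (q (B x) x)" and "0 \<le> \<epsilon>"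
  shows "sn ((2 * w)\<^sup>2 *\<^sub>R x - G c (G c x)) \<le> 2 * (2 * w) * sqrt \<epsilon>"
proof (rule power2_le_imp_le)
  let ?m = "2 * w"
  have 1: "?m\<^sup>2 - 2 * \<epsilon> \<le> (sn (G c x))\<^sup>2"
    using sn_G_power2[OF c, of x] sn_G_power2_le[of "\<i> * c" x] c x by (simp add: norm_mult)
  have "(sn (G c (G c x)))\<^sup>2 \<le> ?m\<^sup>2 * (sn (G c x))\<^sup>2"
    using sn_G_power2_le[OF c, of "G c x"] by simp
  also have "\<dots> \<le> ?m\<^sup>2 * ?m\<^sup>2"
    using sn_G_power2_le[OF c, of x] x by (intro mult_left_mono) auto
  finally have 2: "(sn (G c (G c x)))\<^sup>2 \<le> ?m\<^sup>2 * ?m\<^sup>2" .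
  have "Re (q (?m\<^sup>2 *\<^sub>R x) (G c (G c x))) = ?m\<^sup>2 * (sn (G c x))\<^sup>2"
    by (simp add: q_scaleR_left sn_power2 G_symmetric)
  moreover have "?m\<^sup>2 * (?m\<^sup>2 - 2 * \<epsilon>) \<le> ?m\<^sup>2 * (sn (G c x))\<^sup>2"
    using 1 by (intro mult_left_mono) auto
  moreover have "(sn (?m\<^sup>2 *\<^sub>R x))\<^sup>2 = ?m\<^sup>2 * ?m\<^sup>2"
    using x by (simp add: sn_scaleR power2_eq_square)
  ultimately have "(sn (?m\<^sup>2 *\<^sub>R x - G c (G c x)))\<^sup>2 \<le> 4 * (?m\<^sup>2 * \<epsilon>)"
    unfolding sn_diff_power2 using 2 by (simp add: right_diff_distrib)
  also have "\<dots> = (2 * ?m * sqrt \<epsilon>)\<^sup>2"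
    using \<open>0 \<le> \<epsilon>\<close> by (simp add: power_mult_distrib)
  finally show "(sn (?m\<^sup>2 *\<^sub>R x - G c (G c x)))\<^sup>2 \<le> (2 * ?m * sqrt \<epsilon>)\<^sup>2" .
qed (use w_ge_zero \<open>0 \<le> \<epsilon>\<close> in simp)

text \<open>\<open>G c + G (\<i> * c)\<close> is \<open>sqrt 2\<close> times \<open>G\<close> at the
  index rotated by 45 degrees. Squaring expresses the anticommutator through three squares, each of
  which almost acts as the same scalar on \<open>x\<close>.\<close>

lemma almost_anticommute:
  assumes c: "cmod c = 1" and x: "sn x = 1" "4 * w\<^sup>2 - \<epsilon> \<le> Re (q (B x) x)" and \<epsilon>: "0 \<le> \<epsilon>"
  shows "sn (G c (G (\<i> * c) x) + G (\<i> * c) (G c x)) \<le> 8 * (2 * w) * sqrt \<epsilon>"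
proof -
  let ?d = "cis (pi / 4) * c"
  define z where "z = (2 * w)\<^sup>2 *\<^sub>R x"
  define r where "r e = z - G e (G e x)" for e
  have r: "sn (r e) \<le> 2 * (2 * w) * sqrt \<epsilon>" if "cmod e = 1" for e
    unfolding r_def z_def using that x \<epsilon> by (rule almost_eigenvector)
  have "c + \<i> * c = of_real (sqrt 2) * ?d"
    by (simp add: complex_eq_iff cos_45 sin_45 algebra_simps)
  then have sum: "G c y + G (\<i> * c) y = sqrt 2 *\<^sub>R G ?d y" for y
    by (simp add: G_add_G G_scale_index)
  have "G c (G (\<i> * c) x) + G (\<i> * c) (G c x) + G c (G c x) + G (\<i> * c) (G (\<i> * c) x)
      = sqrt 2 *\<^sub>R G ?d (sqrt 2 *\<^sub>R G ?d x)"
    unfolding sum[symmetric] by (simp add: G_add)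
  also have "\<dots> = 2 *\<^sub>R G ?d (G ?d x)" by (simp add: G_scaleR)
  \<comment> \<open>The copies of \<open>z\<close> cancel, since 1 + 1 - 2 = 0.\<close>
  finally have "G c (G (\<i> * c) x) + G (\<i> * c) (G c x) = r c + r (\<i> * c) - 2 *\<^sub>R r ?d"
    by (simp add: r_def algebra_simps scaleR_2)
  also have "sn \<dots> \<le> sn (r c) + sn (r (\<i> * c)) + 2 * sn (r ?d)"
    using sn_triangle_diff[of "r c + r (\<i> * c)" "2 *\<^sub>R r ?d"] sn_triangle[of "r c" "r (\<i> * c)"]
    by (simp add: sn_scaleR)
  finally show ?thesis
    using r[of c] r[of "\<i> * c"] r[of ?d] c by (simp add: norm_mult)
qed

text \<open>If \<open>h < m = 2 * w\<close> then \<open>m - G c\<close> is bounded below by \<open>m - h\<close>. At an almost extremal \<open>x\<close>,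
  \<open>m - G c\<close> almost annihilates \<open>m x + G c x\<close>, so \<open>G c x\<close> is close to \<open>- m x\<close>; as \<open>J = G (\<i> * c)\<close>
  almost anticommutes with \<open>G c\<close> at \<open>x\<close>, \<open>m - G c\<close> then almost annihilates \<open>J x\<close>, whose
  seminorm is about \<open>m\<close>.\<close>

lemma support_function_ge:
  assumes ext: "\<And>\<epsilon>. 0 < \<epsilon> \<Longrightarrow> \<exists>x. sn x = 1 \<and> 4 * w\<^sup>2 - \<epsilon> \<le> Re (q (B x) x)"
    and c: "cmod c = 1" and h: "\<And>v. Re (q (G c v) v) \<le> h * (sn v)\<^sup>2"
  shows "2 * w \<le> h"
proof (rule ccontr)
  assume "\<not> 2 * w \<le> h"
  define m where "m = 2 * w"
  define d where "d = m - h"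
  have d: "0 < d" using \<open>\<not> 2 * w \<le> h\<close> by (simp add: d_def m_def)
  have m: "0 \<le> m" using w_ge_zero by (simp add: m_def)
  \<comment> \<open>The quadratic form of \<open>m - G c\<close> at \<open>v\<close> is at least
    \<open>d\<close> times the squared seminorm; Cauchy-Schwarz turns this into a lower bound for
    the operator.\<close>
  have below: "d * sn v \<le> sn (m *\<^sub>R v - G c v)" for v
  proof (cases "sn v = 0")
    case False
    have "d * (sn v)\<^sup>2 \<le> m * (sn v)\<^sup>2 - Re (q (G c v) v)"
      using h[of v] by (simp add: d_def left_diff_distrib)
    also have "\<dots> = Re (q (m *\<^sub>R v - G c v) v)"
      by (simp add: q_simps sn_power2)
    also have "\<dots> \<le> sn (m *\<^sub>R v - G c v) * sn v"
      by (rule Re_Cauchy_Schwarz)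
    finally have "d * sn v * sn v \<le> sn (m *\<^sub>R v - G c v) * sn v"
      by (simp add: power2_eq_square mult.assoc)
    then show ?thesis using False sn_ge_zero[of v] by (simp add: mult_le_cancel_right)
  qed simp
  \<comment> \<open>\<open>K\<close> collects the coefficients of \<open>\<epsilon>\<close> in the
    final estimate; its first summand keeps it positive even for \<open>m = 0\<close>.\<close>
  define K where "K = d ^ 4 * 2 + (m + 4 * d)\<^sup>2 * (4 * m\<^sup>2)"
  have ineq: "d ^ 4 * m\<^sup>2 \<le> \<epsilon> * K" if \<epsilon>: "0 < \<epsilon>" for \<epsilon>
  proof -
    obtain x where x: "sn x = 1" "4 * w\<^sup>2 - \<epsilon> \<le> Re (q (B x) x)" using ext[OF \<epsilon>] by blast
    let ?J = "G (\<i> * c)"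
    define \<eta> where "\<eta> = 2 * m * sqrt \<epsilon>"
    let ?y = "m *\<^sub>R x + G c x"
    \<comment> \<open>Factorisation \<open>(m - G c) (m + G c) = m^2 - (G c)^2\<close> applied to
      \<open>x\<close>.\<close>
    have "m *\<^sub>R ?y - G c ?y = m\<^sup>2 *\<^sub>R x - G c (G c x)"
      by (simp add: G_add G_scaleR scaleR_add_right power2_eq_square)
    then have 1: "d * sn ?y \<le> \<eta>"
      using below[of ?y] almost_eigenvector[OF c x] \<epsilon> by (simp add: m_def \<eta>_def)
    have anti: "sn (G c (?J x) + ?J (G c x)) \<le> 4 * \<eta>"
      using almost_anticommute[OF c x] \<epsilon> by (simp add: m_def \<eta>_def)
    have "m *\<^sub>R ?J x - G c (?J x) = ?J ?y - (G c (?J x) + ?J (G c x))"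
      by (simp add: G_add G_scaleR)
    with below[of "?J x"] have "d * sn (?J x) \<le> sn (?J ?y - (G c (?J x) + ?J (G c x)))"
      by (simp only:)
    then have "d * sn (?J x) \<le> sn (?J ?y) + sn (G c (?J x) + ?J (G c x))"
      using sn_triangle_diff[of "?J ?y" "G c (?J x) + ?J (G c x)"] by (rule order_trans)
    also have "\<dots> \<le> m * sn ?y + 4 * \<eta>"
      using sn_G_le[of "\<i> * c" ?y] c anti by (simp add: m_def norm_mult)
    finally have "d * (d * sn (?J x)) \<le> d * (m * sn ?y + 4 * \<eta>)"
      using d by (intro mult_left_mono) auto
    also have "\<dots> = m * (d * sn ?y) + 4 * d * \<eta>" by (simp add: algebra_simps)
    also have "\<dots> \<le> m * \<eta> + 4 * d * \<eta>" using 1 m by (intro add_right_mono mult_left_mono) auto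
    finally have "d\<^sup>2 * sn (?J x) \<le> (m + 4 * d) * \<eta>"
      by (simp add: power2_eq_square algebra_simps)
    then have "(d\<^sup>2 * sn (?J x))\<^sup>2 \<le> ((m + 4 * d) * \<eta>)\<^sup>2"
      using d by (intro power_mono) auto
    also have "\<dots> = (m + 4 * d)\<^sup>2 * (4 * m\<^sup>2) * \<epsilon>"
      using \<epsilon> by (simp add: \<eta>_def power_mult_distrib)
    finally have 2: "d ^ 4 * (sn (?J x))\<^sup>2 \<le> (m + 4 * d)\<^sup>2 * (4 * m\<^sup>2) * \<epsilon>"
      by (simp add: power_mult_distrib)
    \<comment> \<open>The roles in the parallelogram identity are exchanged: the upper bound on
      \<open>G c x\<close> leaves this much for \<open>?J x\<close>.\<close>
    have "m\<^sup>2 - 2 * \<epsilon> \<le> (sn (?J x))\<^sup>2"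
      using sn_G_power2[OF c, of x] sn_G_power2_le[OF c, of x] x by (simp add: m_def)
    then have "d ^ 4 * (m\<^sup>2 - 2 * \<epsilon>) \<le> d ^ 4 * (sn (?J x))\<^sup>2"
      using d by (intro mult_left_mono) auto
    with 2 show ?thesis by (simp add: K_def algebra_simps)
  qed
  have K: "0 < K" using d by (simp add: K_def add_pos_nonneg)
  have "d ^ 4 * m\<^sup>2 \<le> 0"
  proof (rule field_le_epsilon)
    fix e :: real assume "0 < e"
    then show "d ^ 4 * m\<^sup>2 \<le> 0 + e" using ineq[of "e / K"] K by simp
  qed
  \<comment> \<open>In this degenerate case \<open>G c\<close> has seminorm 0 everywhere, which
    contradicts \<open>below\<close> at a unit vector.\<close>
  then have "m = 0" using d by (simp add: mult_le_0_iff)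
  obtain x where x: "sn x = 1" using ext[of 1] by auto
  have "sn (m *\<^sub>R x - G c x) = 0"
    using sn_G_le[OF c, of x] \<open>m = 0\<close> by (simp add: m_def order_antisym)
  then show False using below[of x] x d by simp
qed

text \<open>A hyperplane separating a missing point \<open>p\<close> from the convex numerical range
  would give a direction whose support value is at most \<open>cmod p < w\<close>, against
  \<open>support_function_ge\<close>.\<close>

lemma ball_subset_numrange:
  assumes ext: "\<And>\<epsilon>. 0 < \<epsilon> \<Longrightarrow> \<exists>x. sn x = 1 \<and> 4 * w\<^sup>2 - \<epsilon> \<le> Re (q (B x) x)"
  shows "ball 0 w \<subseteq> numrange"
proof
  fix p :: complex
  assume "p \<in> ball 0 w"
  then have p: "cmod p < w" by simp
  show "p \<in> numrange"
  proof (rule ccontr)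
    assume "p \<notin> numrange"
    moreover have "numrange \<noteq> {}" using ext[of 1] by (auto simp: numrange_def)
    ultimately obtain a b where a: "a \<noteq> 0" and ab: "\<forall>z\<in>numrange. inner a z \<le> b" "\<forall>z\<in>{p}. b \<le> inner a z"
      using separating_hyperplane_sets[OF convex_numrange convex_singleton[of p]] by auto
    \<comment> \<open>This turns the real inner product with \<open>a\<close> into
      \<open>cmod a * Re (c * z)\<close>, so the hyperplane is expressed by a rotation.\<close>
    define c where "c = cnj a / of_real (cmod a)"
    have c: "cmod c = 1" using a by (simp add: c_def norm_divide)
    have Re_c: "Re (c * z) = inner a z / cmod a" for z
      by (simp add: c_def inner_complex_def Re_divide_of_real)
    have unit: "Re (c * z) \<le> Re (c * p)" if "z \<in> numrange" for z
      using ab that a unfolding Re_c by (force simp: divide_right_mono)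
    have "Re (q (G c v) v) \<le> 2 * Re (c * p) * (sn v)\<^sup>2" for v
    proof (cases "sn v = 0")
      case True
      then show ?thesis by (simp add: Re_q_G q_T_null)
    next
      case False
      have "q (T v) v / of_real ((sn v)\<^sup>2) \<in> numrange"
        using False by (intro numrangeI) auto
      from unit[OF this] have "Re (c * q (T v) v / of_real ((sn v)\<^sup>2)) \<le> Re (c * p)"
        by simp
      then have "Re (c * q (T v) v) \<le> Re (c * p) * (sn v)\<^sup>2"
        using False sn_ge_zero[of v] by (simp only: Re_divide_of_real) (simp add: divide_le_eq)
      then show ?thesis unfolding Re_q_G by linarith
    qed
    from support_function_ge[OF ext c this] have "w \<le> Re (c * p)" by simp
    also have "\<dots> \<le> cmod p" using complex_Re_le_cmod[of "c * p"] c by (simp add: norm_mult)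
    finally show False using p by simp
  qed
qed

end

section \<open>Numerical radius and the disk criteria\<close>

definition radius :: real where
  "radius = unit_sup (\<lambda>x. cmod (q (T x) x))"

text \<open>The homogeneous form of the supremum bound, covering null vectors too; it allows
  \<open>w = radius\<close> in the preceding results.\<close>

lemma radius_le: "cmod (q (T x) x) \<le> radius * (sn x)\<^sup>2"
proof (cases "sn x = 0")
  case True
  then show ?thesis by (simp add: q_T_null)
next
  case False
  have bdd: "cmod (q (T u) u) \<le> C" if "sn u = 1" for u
    using Cauchy_Schwarz[of "T u" u] T_bounded[of u] that by simp
  let ?u = "(1 / sn x) *\<^sub>R x"
  have Tu: "T ?u = (1 / sn x) *\<^sub>R T x"
    using T_scaleC[of "of_real (1 / sn x)" x] unfolding scaleC_of_real .
  have "cmod (q (T ?u) ?u) \<le> radius"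
    unfolding radius_def using bdd False by (intro unit_sup_upper) (auto simp: sn_scaleR)
  then show ?thesis
    unfolding Tu using False sn_ge_zero[of x]
    by (simp add: q_scaleR_left q_scaleR_right norm_mult norm_divide power2_eq_square field_simps)
qed

lemma numrange_subset_cball: "numrange \<subseteq> cball 0 radius"
proof
  fix z
  assume "z \<in> numrange"
  then obtain x where "sn x = 1" "z = q (T x) x" by (auto simp: numrange_def)
  then show "z \<in> cball 0 radius" using radius_le[of x] by simp
qed

lemma radius_ge_zero: "0 \<le> radius"
  unfolding radius_def
proof (rule unit_sup_ge_zero)
  show "cmod (q (T u) u) \<le> C" if "sn u = 1" for u
    using Cauchy_Schwarz[of "T u" u] T_bounded[of u] that by simp
qed

text \<open>The easy direction of both equivalences. The open ball alone determines the lower bound: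
  a real number strictly between \<open>radius\<close> and \<open>r\<close> would lie in the
  numerical range.\<close>

lemma circular_disk_radius:
  assumes "circular_disk_at_0 numrange r"
  shows "radius = r"
proof (rule antisym)
  have r: "0 \<le> r" "ball 0 r \<subseteq> numrange" "numrange \<subseteq> cball 0 r"
    using assms by (auto simp: circular_disk_at_0_def)
  show "radius \<le> r"
    unfolding radius_def
  proof (rule unit_sup_least)
    show "cmod (q (T x) x) \<le> r" if "sn x = 1" for x
      using r(3) that by (auto simp: numrange_def subset_iff)
  qed (rule r)
  show "r \<le> radius"
  proof (rule ccontr)
    assume "\<not> r \<le> radius"
    then obtain s where s: "radius < s" "s < r" using dense[of radius r] by auto
    then have "complex_of_real s \<in> ball 0 r" using radius_ge_zero by simp
    then have "complex_of_real s \<in> cball 0 radius" using r(2) numrange_subset_cball by blast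
    then show False using s by simp
  qed
qed

text \<open>The quadratic form of \<open>B\<close> is a sum of two squares, so an upper bound
  already bounds its absolute value.\<close>

lemma sn_B_le:
  assumes "\<And>x. Re (q (B x) x) \<le> K * (sn x)\<^sup>2" and "0 \<le> K"
  shows "sn (B x) \<le> K * sn x"
proof (rule symmetric_bound[where H = B])
  show "\<bar>Re (q (B x) x)\<bar> \<le> K * (sn x)\<^sup>2" for x
    using assms(1)[of x] by (simp add: Re_q_B)
qed (simp_all add: B_add B_scaleC B_symmetric assms)

lemma sn_B_le_radius: "sn (B x) \<le> 4 * radius\<^sup>2 * sn x"
  using sn_B_le[OF Re_q_B_le[OF radius_ge_zero radius_le]] by simp

lemma unit_sup_B_le: "unit_sup (\<lambda>x. sn (B x)) \<le> 4 * radius\<^sup>2"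
proof (rule unit_sup_least)
  show "sn (B x) \<le> 4 * radius\<^sup>2" if "sn x = 1" for x
    using sn_B_le_radius[of x] that by simp
qed simp

text \<open>The squared seminorm of \<open>T x\<close> is one of the two squares in
  \<open>Re_q_B\<close>, and Cauchy-Schwarz bounds their sum by \<open>sn (B x)\<close> on unit
  vectors.\<close>

lemma unit_sup_T_le: "(unit_sup (\<lambda>x. sn (T x)))\<^sup>2 \<le> unit_sup (\<lambda>x. sn (B x))"
proof -
  have upper: "sn (B x) \<le> unit_sup (\<lambda>x. sn (B x))" if "sn x = 1" for x
    using sn_B_le_radius that by (intro unit_sup_upper[where K = "4 * radius\<^sup>2"]) (metis mult_1_right)+
  have nonneg: "0 \<le> unit_sup (\<lambda>x. sn (B x))"
    using sn_B_le_radius by (intro unit_sup_ge_zero[where K = "4 * radius\<^sup>2"]) (metis mult_1_right)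
  have "unit_sup (\<lambda>x. sn (T x)) \<le> sqrt (unit_sup (\<lambda>x. sn (B x)))"
  proof (rule unit_sup_least)
    fix x assume x: "sn x = 1"
    have "(sn (T x))\<^sup>2 \<le> Re (q (B x) x)" by (simp add: Re_q_B)
    also have "\<dots> \<le> sn (B x)" using Re_Cauchy_Schwarz[of "B x" x] x by simp
    also have "\<dots> \<le> unit_sup (\<lambda>x. sn (B x))" by (rule upper[OF x])
    finally show "sn (T x) \<le> sqrt (unit_sup (\<lambda>x. sn (B x)))" by (rule real_le_rsqrt)
  qed (simp add: nonneg)
  moreover have "0 \<le> unit_sup (\<lambda>x. sn (T x))"
    using T_bounded by (intro unit_sup_ge_zero[where K = C]) (metis mult_1_right)
  ultimately show ?thesis using nonneg by (metis power_mono real_sqrt_pow2)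
qed

text \<open>Extremality of the operator seminorm passes to the quadratic form: a gap below
  \<open>4 * radius^2\<close> in the form would, by \<open>sn_B_le\<close>, be a gap in the
  supremum.\<close>

lemma circular_disk_if_extremal:
  assumes "unit_sup (\<lambda>x. sn (B x)) = 4 * radius\<^sup>2"
  shows "circular_disk_at_0 numrange radius"
proof -
  have "ball 0 radius \<subseteq> numrange"
  proof (cases "radius = 0")
    case False
    then have pos: "0 < radius" using radius_ge_zero by simp
    have "\<exists>x. sn x = 1 \<and> 4 * radius\<^sup>2 - \<epsilon> \<le> Re (q (B x) x)" if \<epsilon>: "0 < \<epsilon>" for \<epsilon>
    proof (rule ccontr)
      assume "\<not> ?thesis"
      then have less: "Re (q (B x) x) < 4 * radius\<^sup>2 - \<epsilon>" if "sn x = 1" for x using that by force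
      \<comment> \<open>Truncation at 0 meets the sign condition of \<open>sn_B_le\<close>;
        positivity of \<open>radius\<close> keeps \<open>K\<close> strictly below
        \<open>4 * radius^2\<close>.\<close>
      define K where "K = max 0 (4 * radius\<^sup>2 - \<epsilon>)"
      have unit: "Re (q (B x) x) \<le> K" if "sn x = 1" for x
        using less[OF that] by (simp add: K_def)
      have "Re (q (B x) x) \<le> K * (sn x)\<^sup>2" for x
      proof (cases "sn x = 0")
        case True
        then show ?thesis using Re_Cauchy_Schwarz[of "B x" x] by simp
      next
        case False
        let ?u = "(1 / sn x) *\<^sub>R x"
        have Bu: "B ?u = (1 / sn x) *\<^sub>R B x"
          using B_scaleC[of "of_real (1 / sn x)" x] unfolding scaleC_of_real .
        have "Re (q (B ?u) ?u) \<le> K" using False by (intro unit) (simp add: sn_scaleR)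
        then have "Re (q (B x) x) / (sn x)\<^sup>2 \<le> K"
          unfolding Bu by (simp add: q_scaleR_left q_scaleR_right power2_eq_square)
        then show ?thesis using False by (simp add: divide_le_eq)
      qed
      then have "sn (B x) \<le> K * sn x" for x by (rule sn_B_le) (simp add: K_def)
      then have "unit_sup (\<lambda>x. sn (B x)) \<le> K"
        by (intro unit_sup_least) (auto simp: K_def dest: spec, metis mult_1_right)
      moreover have "K < 4 * radius\<^sup>2" using pos \<epsilon> by (simp add: K_def)
      ultimately show False using assms by simp
    qed
    then show ?thesis by (rule ball_subset_numrange[OF radius_ge_zero radius_le])
  qed simp
  then show ?thesis
    using radius_ge_zero numrange_subset_cball by (simp add: circular_disk_at_0_def)
qed

lemma circular_disk_iff_B:
  "radius = sqrt (1 / 4 * unit_sup (\<lambda>x. sn (B x))) \<longleftrightarrow>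
    circular_disk_at_0 numrange (sqrt (1 / 4 * unit_sup (\<lambda>x. sn (B x))))" (is "radius = ?r \<longleftrightarrow> _")
proof
  assume r: "radius = ?r"
  have "0 \<le> unit_sup (\<lambda>x. sn (B x))" by (rule order_trans[OF _ unit_sup_T_le]) simp
  then have "unit_sup (\<lambda>x. sn (B x)) = 4 * radius\<^sup>2" by (simp add: r)
  from circular_disk_if_extremal[OF this] show "circular_disk_at_0 numrange ?r"
    using r by simp
qed (rule circular_disk_radius)

lemma circular_disk_iff_T:
  "radius = 1 / 2 * unit_sup (\<lambda>x. sn (T x)) \<longleftrightarrow>
    circular_disk_at_0 numrange (1 / 2 * unit_sup (\<lambda>x. sn (T x)))" (is "radius = ?r \<longleftrightarrow> _")
proof
  assume r: "radius = ?r"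
  have "4 * radius\<^sup>2 = (unit_sup (\<lambda>x. sn (T x)))\<^sup>2"
    by (simp add: r power2_eq_square)
  \<comment> \<open>The supremum for \<open>B\<close> is squeezed between two quantities that now
    coincide.\<close>
  with unit_sup_T_le unit_sup_B_le have "unit_sup (\<lambda>x. sn (B x)) = 4 * radius\<^sup>2" by linarith
  from circular_disk_if_extremal[OF this] show "circular_disk_at_0 numrange ?r"
    using r by simp
qed (rule circular_disk_radius)

end

section \<open>A spectral radius estimate for symmetric operators\<close>

text \<open>Symmetry and Cauchy-Schwarz give \<open>(g n)^2 \<le> g (2 * n) * g 0\<close> for the
  orbit seminorms. Iterated doubling makes a first ratio \<open>g 1 / g 0\<close> above
  \<open>M\<close> outgrow every multiple of \<open>M ^ n\<close>.\<close>

lemma (in psd_form) symmetric_bound_of_geometric_growth: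
  assumes sym: "\<And>x y. q (S x) y = q x (S y)"
    and growth: "\<And>n. sn ((S ^^ n) x) \<le> K * M ^ n" and M: "0 < M"
  shows "sn (S x) \<le> M * sn x"
proof -
  define g where "g n = sn ((S ^^ n) x)" for n
  have sym_pow: "q ((S ^^ n) u) v = q u ((S ^^ n) v)" for n u v
    by (induction n arbitrary: u v) (simp_all add: sym funpow_swap1)
  have g_sq: "(g n)\<^sup>2 \<le> g (2 * n) * g 0" for n
  proof -
    have "(g n)\<^sup>2 = Re (q ((S ^^ (n + n)) x) x)"
      unfolding g_def sn_power2 funpow_add by (simp add: sym_pow)
    also have "\<dots> \<le> g (n + n) * g 0" unfolding g_def using Re_Cauchy_Schwarz by simp
    finally show ?thesis by (simp add: mult_2)
  qed
  have g_nonneg: "0 \<le> g n" for n by (simp add: g_def)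
  show ?thesis
  proof (cases "g 0 = 0")
    case True
    then show ?thesis using g_sq[of 1] by (simp add: g_def)
  next
    case False
    then have g0: "0 < g 0" using g_nonneg[of 0] by simp
    \<comment> \<open>The inequality \<open>(g 1 / g 0) ^ N \<le> g N / g 0\<close> for
      \<open>N = 2 ^ k\<close>, multiplied out.\<close>
    have pow: "g 1 ^ (2 ^ k) * g 0 \<le> g (2 ^ k) * g 0 ^ (2 ^ k)" for k
    proof (induction k)
      case (Suc k)
      let ?N = "2 ^ k :: nat"
      have "(g 1 ^ (2 * ?N) * g 0) * g 0 = (g 1 ^ ?N * g 0)\<^sup>2"
        by (simp add: power_mult_distrib mult.commute[of 2] power_mult) (simp add: power2_eq_square)
      also have "\<dots> \<le> (g ?N * g 0 ^ ?N)\<^sup>2"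
        using Suc g_nonneg by (intro power_mono) auto
      also have "\<dots> = (g ?N)\<^sup>2 * g 0 ^ (2 * ?N)"
        by (simp add: power_mult_distrib mult.commute[of 2] power_mult)
      also have "\<dots> \<le> g (2 * ?N) * g 0 * g 0 ^ (2 * ?N)"
        using g_sq[of ?N] g_nonneg by (intro mult_right_mono) auto
      finally have "(g 1 ^ (2 * ?N) * g 0) * g 0 \<le> (g (2 * ?N) * g 0 ^ (2 * ?N)) * g 0"
        by (simp add: mult_ac)
      then show ?case using g0 by (simp add: mult_le_cancel_right)
    qed simp
    have "g 1 \<le> M * g 0"
    proof (rule ccontr)
      assume "\<not> g 1 \<le> M * g 0"
      define b where "b = M * g 0"
      have b: "0 < b" "b < g 1" using g0 M \<open>\<not> g 1 \<le> M * g 0\<close> by (simp_all add: b_def)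
      obtain k where k: "K / g 0 < (g 1 / b) ^ k"
        using real_arch_pow[of "g 1 / b" "K / g 0"] b by auto
      \<comment> \<open>The Archimedean exponent is enlarged to a power of two, where
        \<open>pow\<close> applies.\<close>
      also have "\<dots> \<le> (g 1 / b) ^ (2 ^ k)"
        using b by (intro power_increasing) (auto simp: less_imp_le)
      finally have "K * b ^ (2 ^ k) < g 1 ^ (2 ^ k) * g 0"
        using g0 b by (simp add: power_divide field_simps)
      moreover have "g (2 ^ k) * g 0 ^ (2 ^ k) \<le> K * M ^ (2 ^ k) * g 0 ^ (2 ^ k)"
        using growth[of "2 ^ k"] g0 by (intro mult_right_mono) (simp_all add: g_def)
      ultimately show False using pow[of k] by (simp add: b_def power_mult_distrib mult.assoc)
    qed
    then show ?thesis by (simp add: g_def)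
  qed
qed

section \<open>Hilbert space preliminaries\<close>

lemma psd_form_cinner: "psd_form (cinner :: 'a::complex_inner \<Rightarrow> 'a \<Rightarrow> complex)"
  by unfold_locales (rule cinner_commute cinner_add_left cinner_scaleC_left cinner_ge_zero)+

interpretation cinner: psd_form "cinner :: 'a::complex_inner \<Rightarrow> 'a \<Rightarrow> complex"
  rewrites "psd_form.sn (cinner :: 'a \<Rightarrow> 'a \<Rightarrow> complex) = norm"
proof -
  show "psd_form (cinner :: 'a::complex_inner \<Rightarrow> 'a \<Rightarrow> complex)"
    by (rule psd_form_cinner)
  then show "psd_form.sn (cinner :: 'a \<Rightarrow> 'a \<Rightarrow> complex) = norm"
    by (simp add: fun_eq_iff psd_form.sn_def norm_eq_sqrt_cinner)
qed

lemma bounded_linear_cinner_left: "bounded_linear (\<lambda>x. cinner x (y::'a::complex_inner))"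
proof (rule bounded_linear_intro)
  show "cinner (r *\<^sub>R x) y = r *\<^sub>R cinner x y" for r x
    by (simp add: cinner.q_scaleR_left scaleR_conv_of_real)
qed (use cinner.Cauchy_Schwarz in \<open>auto simp: cinner_add_left\<close>)

lemma bounded_linear_scaleC: "bounded_linear (\<lambda>x. c *\<^sub>C (x::'a::complex_inner))"
proof (rule bounded_linear_intro)
  show "c *\<^sub>C r *\<^sub>R x = r *\<^sub>R c *\<^sub>C x" for r and x :: 'a
    by (simp add: scaleC_scaleC mult.commute flip: scaleC_of_real)
  show "norm (c *\<^sub>C x) \<le> norm x * cmod c" for x :: 'a
    by (simp add: cinner.sn_scaleC)
qed (rule scaleC_add_right)

lemma cinner_extensionality:
  fixes u v :: "'a::complex_inner"
  assumes "\<And>x. cinner x u = cinner x v"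
  shows "u = v"
proof -
  have "cinner (u - v) (u - v) = 0" using assms by (simp add: cinner.q_simps)
  then show ?thesis by (simp add: cinner_eq_zero_iff)
qed

text \<open>The representing vector minimises \<open>\<parallel>y\<parallel>\<^sup>2 - 2 Re (f y)\<close> over \<open>S\<close>.\<close>

lemma Riesz_representation:
  fixes S :: "'a::chilbert_space set"
  assumes closed: "closed S" and zero: "0 \<in> S"
    and S_add: "\<And>x y. x \<in> S \<Longrightarrow> y \<in> S \<Longrightarrow> x + y \<in> S"
    and S_scaleC: "\<And>c x. x \<in> S \<Longrightarrow> c *\<^sub>C x \<in> S"
    and f_add: "\<And>x y. f (x + y) = f x + f y" and f_scaleC: "\<And>c x. f (c *\<^sub>C x) = c * f x"
    and f_bound: "\<And>x. cmod (f x) \<le> K * norm x"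
  shows "\<exists>p\<in>S. \<forall>y\<in>S. f y = cinner y p"
proof -
  have S_scaleR: "r *\<^sub>R x \<in> S" if "x \<in> S" for r x
    using S_scaleC[OF that, of "of_real r"] by (simp add: scaleC_of_real)
  have f_scaleR: "f (r *\<^sub>R x) = of_real r * f x" for r x
    using f_scaleC[of "of_real r" x] by (simp add: scaleC_of_real)
  define \<phi> where "\<phi> y = (norm y)\<^sup>2 - 2 * Re (f y)" for y
  have below: "- K\<^sup>2 \<le> \<phi> y" for y
  proof -
    have "0 \<le> (norm y - K)\<^sup>2" by simp
    then show ?thesis using f_bound[of y] complex_Re_le_cmod[of "f y"]
      by (simp add: \<phi>_def power2_diff mult_ac)
  qed
  define d where "d = Inf (\<phi> ` S)"
  have bdd: "bdd_below (\<phi> ` S)" using below by (rule bdd_belowI2)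
  have d_le: "d \<le> \<phi> y" if "y \<in> S" for y
    unfolding d_def using bdd that by (intro cInf_lower) auto
  have "\<exists>y\<in>S. \<phi> y < d + inverse (real (Suc n))" for n
  proof -
    have "Inf (\<phi> ` S) < d + inverse (real (Suc n))" by (simp add: d_def)
    then show ?thesis using zero bdd by (subst (asm) cInf_less_iff) auto
  qed
  then obtain y where y: "y n \<in> S" "\<phi> (y n) < d + inverse (real (Suc n))" for n by metis
  \<comment> \<open>By the parallelogram law the squared distance equals
    \<open>2 * \<phi> u + 2 * \<phi> v\<close> minus four times \<open>\<phi>\<close> at the
    midpoint; hence minimising sequences are Cauchy.\<close>
  have half: "(norm (u - v))\<^sup>2 \<le> 2 * (\<phi> u + \<phi> v - 2 * d)" if "u \<in> S" "v \<in> S" for u v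
  proof -
    let ?w = "(1/2) *\<^sub>R (u + v)"
    have "d \<le> \<phi> ?w" using that by (intro d_le S_scaleR S_add)
    moreover have "4 * \<phi> ?w = (norm (u + v))\<^sup>2 - 4 * Re (f u) - 4 * Re (f v)"
      by (simp only: \<phi>_def f_scaleR f_add cinner.sn_scaleR power_mult_distrib)
         (simp add: power_divide algebra_simps)
    ultimately show ?thesis
      using cinner.sn_parallelogram[of u v] by (simp add: \<phi>_def)
  qed
  have "Cauchy y"
  proof (rule CauchyI)
    fix e :: real assume e: "0 < e"
    then obtain N where N: "inverse (real (Suc N)) < e\<^sup>2 / 4"
      using reals_Archimedean[of "e\<^sup>2 / 4"] by auto
    have "norm (y m - y n) < e" if "N \<le> m" "N \<le> n" for m n
    proof -
      have "inverse (real (Suc k)) \<le> inverse (real (Suc N))" if "N \<le> k" for k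
        using that by (auto intro!: le_imp_inverse_le)
      then have "\<phi> (y k) < d + e\<^sup>2 / 4" if "N \<le> k" for k
        using y(2)[of k] N that by (smt (verit))
      from this[OF \<open>N \<le> m\<close>] this[OF \<open>N \<le> n\<close>] have "2 * (\<phi> (y m) + \<phi> (y n) - 2 * d) < e\<^sup>2"
        by simp
      with half[OF y(1)[of m] y(1)[of n]] have "(norm (y m - y n))\<^sup>2 < e\<^sup>2"
        by (rule order_le_less_trans)
      then show ?thesis using e by (auto intro: power2_less_imp_less)
    qed
    then show "\<exists>M. \<forall>m\<ge>M. \<forall>n\<ge>M. norm (y m - y n) < e" by blast
  qed
  then obtain p where p: "y \<longlonglongrightarrow> p" using Cauchy_convergent convergent_def by blast
  have pS: "p \<in> S" using closed_sequentially[OF closed _ p] y by blast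
  have Re_eq: "Re (f v) = Re (cinner v p)" if v: "v \<in> S" for v
  proof -
    \<comment> \<open>First-order condition at the minimum: the constant term vanishes in the limit,
      so the discriminant forces the linear coefficient to be 0.\<close>
    have "0 \<le> 0 + 2 * t * Re (cinner p v - f v) + t\<^sup>2 * (norm v)\<^sup>2" for t
    proof (rule LIMSEQ_le_const)
      show "(\<lambda>n. inverse (real (Suc n)) + 2 * t * Re (cinner (y n) v - f v) + t\<^sup>2 * (norm v)\<^sup>2)
          \<longlonglongrightarrow> 0 + 2 * t * Re (cinner p v - f v) + t\<^sup>2 * (norm v)\<^sup>2"
        by (intro tendsto_intros LIMSEQ_inverse_real_of_nat bounded_linear.tendsto[OF bounded_linear_cinner_left] p)
      have "0 \<le> inverse (real (Suc n)) + 2 * t * Re (cinner (y n) v - f v) + t\<^sup>2 * (norm v)\<^sup>2" for n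
      proof -
        have "Re (cinner (y n) (t *\<^sub>R v)) = t * Re (cinner (y n) v)"
          by (simp add: cinner.q_scaleR_right)
        then have "\<phi> (y n + t *\<^sub>R v)
            = \<phi> (y n) + 2 * t * Re (cinner (y n) v - f v) + t\<^sup>2 * (norm v)\<^sup>2"
          by (simp add: \<phi>_def cinner.sn_add_power2 f_add f_scaleR power_mult_distrib algebra_simps)
        moreover have "d \<le> \<phi> (y n + t *\<^sub>R v)" using y v by (intro d_le S_add S_scaleR)
        ultimately show ?thesis using y(2)[of n] by linarith
      qed
      then show "\<exists>N. \<forall>n\<ge>N. 0 \<le> inverse (real (Suc n)) + 2 * t * Re (cinner (y n) v - f v)
          + t\<^sup>2 * (norm v)\<^sup>2" by blast
    qed
    from quadratic_nonneg_imp_discriminant[OF this] have "Re (cinner p v - f v) = 0" by simp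
    then show ?thesis using cinner.Re_q_commute[of p v] by simp
  qed
  \<comment> \<open>The imaginary parts follow from the real identity at
    \<open>\<i> v\<close>.\<close>
  have "f v = cinner v p" if "v \<in> S" for v
    using Re_eq[OF that] Re_eq[OF S_scaleC[OF that, of \<i>]]
    by (simp add: f_scaleC cinner_scaleC_left complex_eq_iff)
  with pS show ?thesis by blast
qed

text \<open>Riesz representation of \<open>cinner (T x) y\<close> as a functional of
  \<open>x\<close> gives existence, and nondegeneracy gives uniqueness, so the description defining
  \<open>cadjoint\<close> is justified.\<close>

lemma cinner_cadjoint:
  fixes T :: "'a::chilbert_space \<Rightarrow> 'a"
  assumes T: "bounded_clinear T"
  shows "cinner (T x) y = cinner x (cadjoint T y)"
proof -
  have lin: "bounded_linear T" and scale: "\<And>c x. T (c *\<^sub>C x) = c *\<^sub>C T x"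
    using T by (auto simp: bounded_clinear_def)
  obtain K where K: "\<And>x. norm (T x) \<le> norm x * K"
    using bounded_linear.bounded[OF lin] by blast
  have "\<exists>p. \<forall>x. cinner (T x) y = cinner x p" for y
  proof -
    have "cmod (cinner (T x) y) \<le> K * norm y * norm x" for x
    proof -
      have "cmod (cinner (T x) y) \<le> norm (T x) * norm y" by (rule cinner.Cauchy_Schwarz)
      also have "\<dots> \<le> (norm x * K) * norm y" by (intro mult_right_mono K) auto
      finally show ?thesis by (simp add: mult_ac)
    qed
    then have "\<exists>p\<in>UNIV. \<forall>x\<in>UNIV. cinner (T x) y = cinner x p"
      by (intro Riesz_representation)
         (simp_all add: linear_add[OF bounded_linear.linear[OF lin]] scale cinner.q_simps)
    then show ?thesis by simp
  qed
  then obtain S where S: "\<forall>x y. cinner (T x) y = cinner x (S y)" by metis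
  have "\<exists>!S. \<forall>x y. cinner (T x) y = cinner x (S y)"
  proof (rule ex1I[of _ S])
    show "S' = S" if "\<forall>x y. cinner (T x) y = cinner x (S' y)" for S'
      using that S by (intro ext cinner_extensionality) metis
  qed (rule S)
  from theI'[OF this] show ?thesis unfolding cadjoint_def by blast
qed

text \<open>Closedness of the sublevel sets replaces the closed graph hypothesis of the closed graph
  theorem.\<close>

lemma bounded_linear_of_closed_sublevels:
  fixes X :: "'a::banach \<Rightarrow> 'b::real_normed_vector"
  assumes lin: "linear X" and closed: "\<And>n::nat. closed {x. norm (X x) \<le> real n}"
  shows "bounded_linear X"
proof -
  let ?F = "\<lambda>n::nat. {x. norm (X x) \<le> real n}"
  have "\<exists>n. interior (?F n) \<noteq> {}"
  proof (rule ccontr)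
    assume "\<not> (\<exists>n. interior (?F n) \<noteq> {})"
    then have "euclidean interior_of (\<Union> (range ?F)) = {}"
      using closed by (intro Baire_category_alt disjI1 completely_metrizable_space_euclidean) auto
    moreover have "\<Union> (range ?F) = UNIV" using real_arch_simple by auto
    ultimately show False by simp
  qed
  then obtain n x0 where "x0 \<in> interior (?F n)" by blast
  then obtain e where e: "0 < e" "cball x0 e \<subseteq> ?F n"
    using mem_interior_cball by blast
  \<comment> \<open>A vector of norm \<open>e\<close> is a difference of two points of the ball, so
    its image has norm at most \<open>2 * n\<close>.\<close>
  have "norm (X x) \<le> norm x * (2 * n / e)" for x
  proof (cases "x = 0")
    case False
    let ?z = "(e / norm x) *\<^sub>R x"
    have "x0 + ?z \<in> cball x0 e" "x0 \<in> cball x0 e" using False e by (auto simp: dist_norm)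
    then have "norm (X (x0 + ?z)) \<le> n" "norm (X x0) \<le> n" using subsetD[OF e(2)] by simp_all
    moreover have "X ?z = X (x0 + ?z) - X x0" by (simp add: linear_add[OF lin])
    ultimately have "norm (X ?z) \<le> 2 * n"
      using norm_triangle_ineq4[of "X (x0 + ?z)" "X x0"] by simp
    then show ?thesis using False e by (simp add: linear_scale[OF lin] field_simps)
  qed (simp add: linear_0[OF lin])
  then show ?thesis
    using lin by (intro bounded_linear_intro[of X "2 * n / e"]) (simp_all add: linear_add linear_scale)
qed

section \<open>The \<open>A\<close>-adjoint\<close>

text \<open>Complex polarisation: reality of the form at \<open>x + y\<close> settles the imaginary
  parts, and at \<open>x + \<i> y\<close> the real parts.\<close>

lemma positive_op_symmetric:
  assumes A: "bounded_clinear A" and pos: "positive_op A"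
  shows "cinner (A x) y = cinner x (A y)"
proof -
  have lin: "linear A" and scale: "\<And>c x. A (c *\<^sub>C x) = c *\<^sub>C A x"
    using A by (auto simp: bounded_clinear_def bounded_linear.linear)
  have real: "Im (cinner (A u) u) = 0" for u
    using pos by (auto simp: positive_op_def complex_is_Real_iff)
  have "Im (cinner (A x) y + cinner (A y) x) = 0"
    using real[of "x + y"] real[of x] real[of y]
    by (simp add: linear_add[OF lin] cinner.q_simps)
  moreover have "Re (cinner (A x) y) = Re (cinner (A y) x)"
    using real[of "x + \<i> *\<^sub>C y"] real[of x] real[of y]
    by (simp add: linear_add[OF lin] scale cinner.q_simps)
  ultimately have "cinner (A x) y = cnj (cinner (A y) x)"
    by (simp add: complex_eq_iff)
  then show ?thesis by (metis cinner_commute)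
qed

lemma psd_form_A_inner:
  assumes A: "bounded_clinear A" and pos: "positive_op A"
  shows "psd_form (A_inner A)"
proof
  have lin: "linear A" and scale: "\<And>c x. A (c *\<^sub>C x) = c *\<^sub>C A x"
    using A by (auto simp: bounded_clinear_def bounded_linear.linear)
  show "A_inner A x y = cnj (A_inner A y x)" for x y
    unfolding A_inner_def using positive_op_symmetric[OF A pos, of x y] cinner_commute by metis
  show "A_inner A (x + y) z = A_inner A x z + A_inner A y z" for x y z
    by (simp add: A_inner_def linear_add[OF lin] cinner_add_left)
  show "A_inner A (a *\<^sub>C x) y = a * A_inner A x y" for a x y
    by (simp add: A_inner_def scale cinner_scaleC_left)
  show "0 \<le> Re (A_inner A x x)" for x
    using pos by (simp add: A_inner_def positive_op_def)
qed

text \<open>A preimage of \<open>cadjoint T (A x)\<close> under \<open>A\<close> is projected onto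
  the closure of the range. As \<open>A\<close> is injective there, the choice is unique, hence
  linear in \<open>x\<close>; boundedness comes from closed sublevel sets.\<close>

lemma A_sharp:
  fixes A T :: "'a::chilbert_space \<Rightarrow> 'a"
  assumes A: "bounded_clinear A" and pos: "positive_op A" and T: "T \<in> B_A A"
  shows "bounded_clinear (A_sharp A T) \<and> A \<circ> A_sharp A T = cadjoint T \<circ> A \<and>
    range (A_sharp A T) \<subseteq> closure (range A)"
proof -
  have lin: "bounded_linear A" and scale: "\<And>c x. A (c *\<^sub>C x) = c *\<^sub>C A x"
    using A by (auto simp: bounded_clinear_def)
  have add: "\<And>x y. A (x + y) = A x + A y" and diff: "\<And>x y. A (x - y) = A x - A y"
    using lin by (simp_all add: bounded_linear.linear linear_add linear_diff)
  have sym: "cinner (A x) y = cinner x (A y)" for x y by (rule positive_op_symmetric[OF A pos])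
  have Tc: "bounded_clinear T" and ran: "range (cadjoint T \<circ> A) \<subseteq> range A"
    using T by (auto simp: B_A_def)
  have T_lin: "bounded_linear T" using Tc by (simp add: bounded_clinear_def)
  have adj: "cinner (cadjoint T x) y = cinner x (T y)" for x y
    using cinner_cadjoint[OF Tc, of y x] cinner_commute by metis
  let ?S = "closure (range A)"
  have S_add: "x + y \<in> ?S" if xy: "x \<in> ?S" "y \<in> ?S" for x y
  proof -
    obtain u v where u: "\<And>n. u n \<in> range A" "u \<longlonglongrightarrow> x" and v: "\<And>n. v n \<in> range A" "v \<longlonglongrightarrow> y"
      using xy unfolding closure_sequential by metis
    have "u n + v n \<in> range A" for n
      using u(1)[of n] v(1)[of n] by (auto simp flip: add)
    then show ?thesis
      unfolding closure_sequential using tendsto_add[OF u(2) v(2)] by (intro exI[of _ "\<lambda>n. u n + v n"]) auto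
  qed
  have S_scale: "c *\<^sub>C x \<in> ?S" if x: "x \<in> ?S" for c x
  proof -
    obtain u where u: "\<And>n. u n \<in> range A" "u \<longlonglongrightarrow> x"
      using x unfolding closure_sequential by metis
    have "c *\<^sub>C u n \<in> range A" for n
      using u(1)[of n] by (auto simp flip: scale)
    then show ?thesis
      unfolding closure_sequential using bounded_linear.tendsto[OF bounded_linear_scaleC u(2)]
      by (intro exI[of _ "\<lambda>n. c *\<^sub>C u n"]) auto
  qed
  have S_0: "0 \<in> ?S"
    using closure_subset[of "range A"] linear_0[OF bounded_linear.linear[OF lin]] by (metis rangeI subsetD)
  have S_diff: "x - y \<in> ?S" if "x \<in> ?S" "y \<in> ?S" for x y
    using S_add[OF that(1) S_scale[OF that(2), of "- 1"]] by (simp add: scaleC_minus_one)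
  have dense: "norm (cinner s z) \<le> K * norm s"
    if s: "s \<in> ?S" "\<And>y. norm (cinner (A y) z) \<le> K * norm (A y)" for s z K
  proof -
    obtain u where u: "\<And>n. u n \<in> range A" "u \<longlonglongrightarrow> s"
      using s(1) unfolding closure_sequential by metis
    show ?thesis
    proof (rule LIMSEQ_le)
      show "(\<lambda>n. norm (cinner (u n) z)) \<longlonglongrightarrow> norm (cinner s z)"
        by (intro tendsto_intros bounded_linear.tendsto[OF bounded_linear_cinner_left] u)
      show "(\<lambda>n. K * norm (u n)) \<longlonglongrightarrow> K * norm s" by (intro tendsto_intros u)
      have "norm (cinner (u n) z) \<le> K * norm (u n)" for n using u(1)[of n] s(2) by auto
      then show "\<exists>N. \<forall>n\<ge>N. norm (cinner (u n) z) \<le> K * norm (u n)" by blast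
    qed
  qed
  \<comment> \<open>By symmetry a kernel vector of \<open>A\<close> is orthogonal to
    \<open>range A\<close>, hence to the closure; if it lies in the closure it is orthogonal to
    itself.\<close>
  have inj: "x = y" if "x \<in> ?S" "y \<in> ?S" "A x = A y" for x y
  proof -
    have "A (x - y) = 0" using that(3) by (simp add: diff)
    then have "cinner (A z) (x - y) = 0" for z by (simp add: sym cinner.q_zero)
    then have "norm (cinner (x - y) (x - y)) \<le> 0 * norm (x - y)"
      by (intro dense[OF S_diff[OF that(1,2)]]) simp
    then show ?thesis by (simp add: cinner_eq_zero_iff)
  qed
  have "\<exists>p\<in>?S. A p = cadjoint T (A x)" for x
  proof -
    obtain z where z: "cadjoint T (A x) = A z" using ran by force
    \<comment> \<open>\<open>p\<close> is the orthogonal projection of \<open>z\<close>, obtained by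
      representing the functional \<open>cinner y z\<close> on the closed subspace.\<close>
    have "\<exists>p\<in>?S. \<forall>y\<in>?S. cinner y z = cinner y p"
    proof (rule Riesz_representation)
      show "cmod (cinner y z) \<le> norm z * norm y" for y
        using cinner.Cauchy_Schwarz[of y z] by (simp add: mult.commute)
    qed (auto simp: S_add S_scale S_0 cinner.q_simps)
    then obtain p where p: "p \<in> ?S" "\<forall>y\<in>?S. cinner y z = cinner y p" by blast
    have "A p = A z"
    proof (rule cinner_extensionality)
      show "cinner y (A p) = cinner y (A z)" for y
        using p(2) closure_subset[of "range A"] by (simp add: sym[symmetric] subset_iff)
    qed
    with p z show ?thesis by auto
  qed
  then obtain X where X: "\<And>x. X x \<in> ?S" "\<And>x. A (X x) = cadjoint T (A x)" by metis
  have adj_add: "cadjoint T (x + y) = cadjoint T x + cadjoint T y" for x y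
    by (rule cinner_extensionality) (simp add: cinner.q_simps flip: cinner_cadjoint[OF Tc])
  have adj_scale: "cadjoint T (c *\<^sub>C x) = c *\<^sub>C cadjoint T x" for c x
    by (rule cinner_extensionality) (simp add: cinner.q_simps flip: cinner_cadjoint[OF Tc])
  have X_add: "X (x + y) = X x + X y" for x y
    by (rule inj) (simp_all add: X S_add add adj_add)
  have X_scale: "X (c *\<^sub>C x) = c *\<^sub>C X x" for c x
    by (rule inj) (simp_all add: X S_scale scale adj_scale)
  have X_lin: "linear X"
    using X_add X_scale[of "of_real _"] by (intro linearI) (simp_all add: scaleC_of_real)
  have form: "cinner (A y) (X x) = cinner (T y) (A x)" for x y
    unfolding sym X by (simp add: cinner_cadjoint[OF Tc])
  have "bounded_linear X"
  proof (rule bounded_linear_of_closed_sublevels[OF X_lin])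
    fix n :: nat
    \<comment> \<open>The norm of \<open>X x\<close> can be tested against \<open>range A\<close>,
      since \<open>X x\<close> lies in its closure; \<open>form\<close> rewrites each test as a
      condition continuous in \<open>x\<close>.\<close>
    have "{x. norm (X x) \<le> real n} = (\<Inter>y. {x. norm (cinner (A x) (T y)) \<le> real n * norm (A y)})"
    proof (intro set_eqI iffI; clarsimp)
      fix x y assume "norm (X x) \<le> real n"
      then have "norm (A y) * norm (X x) \<le> norm (A y) * real n" by (intro mult_left_mono) auto
      then show "norm (cinner (A x) (T y)) \<le> real n * norm (A y)"
        using cinner.Cauchy_Schwarz[of "A y" "X x"] form[of y x] cinner_commute[of "A x" "T y"]
        by (simp add: mult.commute)
    next
      fix x assume *: "\<forall>y. norm (cinner (A x) (T y)) \<le> real n * norm (A y)"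
      have "norm (cinner (X x) (X x)) \<le> real n * norm (X x)"
      proof (rule dense[OF X(1)])
        show "norm (cinner (A y) (X x)) \<le> real n * norm (A y)" for y
          using *[rule_format, of y] cinner_commute[of "A x" "T y"] by (simp add: form)
      qed
      then have "norm (X x) * norm (X x) \<le> real n * norm (X x)"
        by (simp add: cinner.q_self_sn power2_eq_square norm_mult)
      then show "norm (X x) \<le> real n" by (cases "X x = 0") simp_all
    qed
    moreover have "closed {x. norm (cinner (A x) (T y)) \<le> real n * norm (A y)}" for y
      by (intro closed_Collect_le continuous_intros bounded_linear.continuous_on[OF bounded_linear_cinner_left]
          bounded_linear.continuous_on[OF lin])
    ultimately show "closed {x. norm (X x) \<le> real n}" by auto
  qed
  then have "bounded_clinear X" using X_scale by (simp add: bounded_clinear_def)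
  then have ex: "bounded_clinear X \<and> A \<circ> X = cadjoint T \<circ> A \<and> range X \<subseteq> closure (range A)"
    using X by auto
  have "\<exists>!X. bounded_clinear X \<and> A \<circ> X = cadjoint T \<circ> A \<and> range X \<subseteq> closure (range A)"
  proof (rule ex1I[of _ X])
    show "Y = X" if Y: "bounded_clinear Y \<and> A \<circ> Y = cadjoint T \<circ> A \<and> range Y \<subseteq> closure (range A)" for Y
    proof
      fix x
      have "(A \<circ> Y) x = (cadjoint T \<circ> A) x" "Y x \<in> ?S" using Y by auto
      then show "Y x = X x" using X(2)[of x] by (intro inj[OF _ X(1)]) simp_all
    qed
  qed (rule ex)
  from theI'[OF this] show ?thesis unfolding A_sharp_def .
qed

section \<open>Boundedness in the \<open>A\<close>-seminorm\<close>

text \<open>\<open>X \<circ> T\<close> is symmetric for the form, and norm boundedness makes its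
  iterates grow at most geometrically, also in the weaker seminorm. The spectral radius estimate
  bounds it, and its quadratic form is the squared seminorm of \<open>T x\<close>.\<close>

lemma A_bounded:
  fixes A T :: "'a::chilbert_space \<Rightarrow> 'a"
  assumes A: "bounded_clinear A" and pos: "positive_op A"
    and T: "bounded_linear T" and X: "bounded_linear X"
    and adj: "\<And>x y. A_inner A (T x) y = A_inner A x (X y)"
  shows "\<exists>C. \<forall>x. A_norm A (T x) \<le> C * A_norm A x"
proof -
  interpret psd_form "A_inner A" by (rule psd_form_A_inner[OF A pos])
  have sn: "sn x = A_norm A x" for x by (simp add: sn_def A_norm_def)
  have adj': "A_inner A (X x) y = A_inner A x (T y)" for x y
    by (subst (1 2) q_commute) (simp add: adj)
  obtain a where a: "0 < a" "\<And>x. norm (A x) \<le> norm x * a"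
    using bounded_linear.pos_bounded[of A] A by (auto simp: bounded_clinear_def)
  have sn_le: "sn x \<le> sqrt a * norm x" for x
  proof -
    have "Re (A_inner A x x) \<le> norm (A x) * norm x"
      using cinner.Re_Cauchy_Schwarz[of "A x" x] by (simp add: A_inner_def)
    also have "\<dots> \<le> norm x * a * norm x" by (intro mult_right_mono a) auto
    finally have "sn x \<le> sqrt (a * (norm x)\<^sup>2)"
      by (simp add: sn_def power2_eq_square mult_ac)
    then show ?thesis by (simp add: real_sqrt_mult)
  qed
  define S where "S = X \<circ> T"
  have "bounded_linear S" unfolding S_def by (rule bounded_linear_compose[OF X T, folded comp_def])
  then obtain M where M: "0 < M" "\<And>x. norm (S x) \<le> norm x * M"
    using bounded_linear.pos_bounded by blast
  have pow: "norm ((S ^^ n) x) \<le> norm x * M ^ n" for n x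
  proof (induction n)
    case (Suc n)
    have "norm ((S ^^ Suc n) x) \<le> norm ((S ^^ n) x) * M" using M(2) by simp
    also have "\<dots> \<le> norm x * M ^ n * M" using Suc M(1) by (intro mult_right_mono) auto
    finally show ?case by (simp add: mult_ac)
  qed simp
  have S_bound: "sn (S x) \<le> M * sn x" for x
  proof (rule symmetric_bound_of_geometric_growth)
    show "A_inner A (S u) v = A_inner A u (S v)" for u v by (simp add: S_def adj adj')
    show "sn ((S ^^ n) x) \<le> (sqrt a * norm x) * M ^ n" for n
    proof -
      have "sn ((S ^^ n) x) \<le> sqrt a * norm ((S ^^ n) x)" by (rule sn_le)
      also have "\<dots> \<le> sqrt a * (norm x * M ^ n)" using a(1) by (intro mult_left_mono pow) auto
      finally show ?thesis by (simp add: mult_ac)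
    qed
  qed (rule M)
  have "sn (T x) \<le> sqrt M * sn x" for x
  proof -
    have "(sn (T x))\<^sup>2 = Re (A_inner A (S x) x)" by (simp add: sn_power2 S_def adj adj')
    also have "\<dots> \<le> sn (S x) * sn x" by (rule Re_Cauchy_Schwarz)
    also have "\<dots> \<le> M * sn x * sn x" by (intro mult_right_mono S_bound) auto
    finally have "(sn (T x))\<^sup>2 \<le> (sqrt M * sn x)\<^sup>2"
      using M(1) by (simp add: power_mult_distrib) (simp add: power2_eq_square mult.assoc)
    then show ?thesis by (rule power2_le_imp_le) (use M(1) in simp)
  qed
  then show ?thesis unfolding sn by blast
qed

section \<open>Transfer to the \<open>A\<close>-numerical range\<close>

theorem theorem2p8:
  fixes A T :: "'a::chilbert_space \<Rightarrow> 'a"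
  assumes "bounded_clinear A" and "positive_op A" and "T \<in> B_A A"
  shows "(A_numradius A T = 1 / 2 * A_opnorm A T \<longleftrightarrow>
           circular_disk_at_0 (A_numrange A T) (1 / 2 * A_opnorm A T)) \<and>
         (A_numradius A T
             = sqrt (1 / 4 * A_opnorm A (\<lambda>x. A_sharp A T (T x) + T (A_sharp A T x))) \<longleftrightarrow>
           circular_disk_at_0 (A_numrange A T)
             (sqrt (1 / 4 * A_opnorm A (\<lambda>x. A_sharp A T (T x) + T (A_sharp A T x)))))"
proof -
  let ?X = "A_sharp A T"
  note A = assms(1) and pos = assms(2)
  have T: "bounded_clinear T" using assms(3) by (simp add: B_A_def)
  have X: "bounded_clinear ?X" "A \<circ> ?X = cadjoint T \<circ> A" using A_sharp[OF assms] by auto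
  have lin: "bounded_linear T" "bounded_linear ?X" using T X(1) by (simp_all add: bounded_clinear_def)
  \<comment> \<open>The defining equation of \<open>A_sharp\<close>, combined with symmetry of
    \<open>A\<close>, says that \<open>?X\<close> is adjoint to \<open>T\<close> for the
    \<open>A\<close>-form.\<close>
  have adj: "A_inner A (T x) y = A_inner A x (?X y)" for x y
  proof -
    have "cinner (A (T x)) y = cinner (T x) (A y)" by (rule positive_op_symmetric[OF A pos])
    also have "\<dots> = cinner x (cadjoint T (A y))" by (rule cinner_cadjoint[OF T])
    also have "cadjoint T (A y) = A (?X y)" using X(2) by (metis comp_apply)
    also have "cinner x (A (?X y)) = cinner (A x) (?X y)" by (rule positive_op_symmetric[OF A pos, symmetric])
    finally show ?thesis by (simp add: A_inner_def)
  qed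
  interpret psd_form "A_inner A" by (rule psd_form_A_inner[OF A pos])
  have sn: "sn = A_norm A" by (simp add: fun_eq_iff sn_def A_norm_def)
  obtain C where C: "\<And>x. sn (T x) \<le> C * sn x"
    using A_bounded[OF A pos lin adj] unfolding sn by blast
  interpret adjoint_pair "A_inner A" T ?X C
    using T X(1) lin adj C
    by unfold_locales (simp_all add: bounded_clinear_def linear_add bounded_linear.linear)
  have "A_numradius A T = radius" "A_numrange A T = numrange"
    "A_opnorm A T = unit_sup (\<lambda>x. sn (T x))"
    "A_opnorm A (\<lambda>x. ?X (T x) + T (?X x)) = unit_sup (\<lambda>x. sn (B x))"
    by (simp_all add: A_numradius_def A_numrange_def A_opnorm_def radius_def numrange_def
        unit_sup_def sn B_def)
  then show ?thesis using circular_disk_iff_T circular_disk_iff_B by simp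
qed

end
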